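(* Consider a queueing system in which the null state (the empty queue) is recurrent. Among all service disciplines, Last-Come-First-Served (LCFS) maximizes the variance $\operatorname{Var}[W]$ of the waiting time $W$; that is, for every service discipline $D$, $$\operatorname{Var}_{D}[W]\le \operatorname{Var}_{\mathrm{LCFS}}[W].$$ The variances are not required to be finite: if the variance of the waiting time is infinite for some service discipline, then it is infinite for LCFS.
   Context: Customers arrive at a queueing system and wait until they begin service. The waiting time $W$ of a customer is the time from arrival to the beginning of service, and $\operatorname{Var}[W]=\operatorname{Ex}[W^2]-\operatorname{Ex}[W]^2$ is its variance, where $\operatorname{Ex}$ denotes expectation; $\operatorname{Var}_D[W]$ denotes this variance when service discipline $D$ is used. A service discipline is a rule specifying which waiting customer is to be served when a server becomes free. LCFS is the discipline that serves, among the customers then waiting, the one who arrived most recently. Disciplines are compared in the following setting. In a busy period (which is initiated by the arrival of a customer to the empty system) with $n$ customers, let $a_1<a_2<\cdots<a_n$ be the arrival times and $b_1<b_2<\cdots<b_n$ the beginnings of the service intervals; these do not depend on the service discipline. The discipline determines a permutation $\pi$ of $\{1,\ldots,n\}$ such that the customer arriving at time $a_i$ begins service at time $b_{\pi(i)}$, and so has waiting time $b_{\pi(i)}-a_i$. The first customer is served immediately under every discipline, so $a_1=b_1$ and $\pi(1)=1$, and no customer can be served before arriving. The average waiting time $\operatorname{Ex}[W]$ does not depend on the service discipline. *)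

theory Defs
  imports "HOL-Probability.Probability"
begin

text \<open>
  Customers are indexed by the integers in order of arrival, and service intervals by the integers
  in order of their beginnings: \<open>A k\<close> is the arrival time of customer \<open>k\<close>, and the \<open>k\<close>-th service
  interval lasts from \<open>B k\<close> to \<open>C k\<close>. None of these depends on the service discipline; the discipline
  only decides which customer occupies which service interval. The two numberings are aligned in
  such a way that a customer \<open>k\<close> who arrives to the empty system occupies service interval \<open>k\<close>.
  Nothing is assumed about the number of servers or about independence.

  We first describe a single sample path \<open>a, b, c :: int \<Rightarrow> real\<close>. The system is empty just before
  time \<open>t\<close> if, for every customer \<open>k\<close> who arrived before \<open>t\<close>, the \<open>k\<close>-th service has been completed
  by time \<open>t\<close>, so that there have been as many departures as arrivals. (A departure at the very instant \<open>t\<close> counts as having taken place.)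
\<close>

definition null_state :: "(int \<Rightarrow> real) \<Rightarrow> (int \<Rightarrow> real) \<Rightarrow> real \<Rightarrow> bool" where
  "null_state a c t \<longleftrightarrow> (\<forall>k. a k < t \<longrightarrow> c k \<le> t)"

text \<open>The customer who initiates the busy period to which customer \<open>j\<close> belongs.\<close>

definition busy_start :: "(int \<Rightarrow> real) \<Rightarrow> (int \<Rightarrow> real) \<Rightarrow> int \<Rightarrow> int" where
  "busy_start a c j = (GREATEST i. i \<le> j \<and> null_state a c (a i))"

text \<open>
  On a sample path a service discipline acts as a function \<open>d :: int \<Rightarrow> int set \<Rightarrow> int\<close>: at the
  beginning of service interval \<open>k\<close>, when \<open>S\<close> is the set of waiting customers, customer \<open>d k S\<close> is
  taken into service. In a busy period initiated by customer \<open>s\<close> the service intervals are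
  \<open>s, s + 1, \<dots>\<close>. The set \<open>served a b d s n\<close> consists of the customers taken into the first \<open>n\<close> of
  them, and \<open>waiting a b d s n\<close> of those waiting when the next service begins (including one who
  arrives at that very instant).
\<close>

fun served :: "(int \<Rightarrow> real) \<Rightarrow> (int \<Rightarrow> real) \<Rightarrow> (int \<Rightarrow> int set \<Rightarrow> int) \<Rightarrow> int \<Rightarrow> nat \<Rightarrow> int set" where
  "served a b d s 0 = {}"
| "served a b d s (Suc n) =
     insert (d (s + int n) ({j. s \<le> j \<and> a j \<le> b (s + int n)} - served a b d s n))
       (served a b d s n)"

definition waiting ::
  "(int \<Rightarrow> real) \<Rightarrow> (int \<Rightarrow> real) \<Rightarrow> (int \<Rightarrow> int set \<Rightarrow> int) \<Rightarrow> int \<Rightarrow> nat \<Rightarrow> int set" where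
  "waiting a b d s n = {j. s \<le> j \<and> a j \<le> b (s + int n)} - served a b d s n"

text \<open>
  The permutation \<open>\<pi>\<close> determined by the discipline: customer \<open>j\<close> occupies service interval
  \<open>service_index a b c d j\<close>. (A customer taken into service is never waiting again, so the
  \<open>n\<close> below is unique.)
\<close>

definition service_index ::
  "(int \<Rightarrow> real) \<Rightarrow> (int \<Rightarrow> real) \<Rightarrow> (int \<Rightarrow> real) \<Rightarrow> (int \<Rightarrow> int set \<Rightarrow> int) \<Rightarrow> int \<Rightarrow> int" where
  "service_index a b c d j =
     (let s = busy_start a c j in s + int (LEAST n. d (s + int n) (waiting a b d s n) = j))"

definition waiting_time ::
  "(int \<Rightarrow> 'w \<Rightarrow> real) \<Rightarrow> (int \<Rightarrow> 'w \<Rightarrow> real) \<Rightarrow> (int \<Rightarrow> 'w \<Rightarrow> real) \<Rightarrow>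
   ('w \<Rightarrow> int \<Rightarrow> int set \<Rightarrow> int) \<Rightarrow> int \<Rightarrow> 'w \<Rightarrow> real" where
  "waiting_time A B C D j \<omega> =
     B (service_index (\<lambda>k. A k \<omega>) (\<lambda>k. B k \<omega>) (\<lambda>k. C k \<omega>) (D \<omega>) j) \<omega> - A j \<omega>"

text \<open>
  A queueing system in steady state, seen by its customers. The time origin is the arrival of
  customer \<open>0\<close>, and the measure preserving map \<open>T\<close> passes from the point of view of customer \<open>0\<close> to
  that of customer \<open>1\<close>: it renumbers the customers and moves the time origin to the arrival of
  customer \<open>1\<close>. Hence customer \<open>0\<close> is a typical customer. The sample point \<open>\<omega>\<close> need not be determined
  by the arrival and service times: it may carry further randomness to be used by a discipline.
\<close>

locale queueing_system = prob_space M for M :: "'w measure" +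
  fixes T :: "'w \<Rightarrow> 'w" and A B C :: "int \<Rightarrow> 'w \<Rightarrow> real"
  assumes A_measurable [measurable]: "\<And>k. A k \<in> borel_measurable M"
    and B_measurable [measurable]: "\<And>k. B k \<in> borel_measurable M"
    and C_measurable [measurable]: "\<And>k. C k \<in> borel_measurable M"
    and T_measurable [measurable]: "T \<in> measurable M M"
    and T_preserving: "distr M M T = M"
    and origin: "\<And>\<omega>. \<omega> \<in> space M \<Longrightarrow> A 0 \<omega> = 0"
    and A_shift: "\<And>\<omega> k. \<omega> \<in> space M \<Longrightarrow> A k (T \<omega>) = A (k + 1) \<omega> - A 1 \<omega>"
    and B_shift: "\<And>\<omega> k. \<omega> \<in> space M \<Longrightarrow> B k (T \<omega>) = B (k + 1) \<omega> - A 1 \<omega>"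
    and C_shift: "\<And>\<omega> k. \<omega> \<in> space M \<Longrightarrow> C k (T \<omega>) = C (k + 1) \<omega> - A 1 \<omega>"
    and A_strict: "\<And>\<omega>. \<omega> \<in> space M \<Longrightarrow> strict_mono (\<lambda>k. A k \<omega>)"
    and B_strict: "\<And>\<omega>. \<omega> \<in> space M \<Longrightarrow> strict_mono (\<lambda>k. B k \<omega>)"
    and A_unbounded: "\<And>\<omega>. \<omega> \<in> space M \<Longrightarrow> filterlim (\<lambda>k. A k \<omega>) at_top at_top"
    and A_le_B: "\<And>\<omega> k. \<omega> \<in> space M \<Longrightarrow> A k \<omega> \<le> B k \<omega>"
    and B_le_C: "\<And>\<omega> k. \<omega> \<in> space M \<Longrightarrow> B k \<omega> \<le> C k \<omega>"
    and immediate_service: "\<And>\<omega> k. \<omega> \<in> space M \<Longrightarrow>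
      null_state (\<lambda>k. A k \<omega>) (\<lambda>k. C k \<omega>) (A k \<omega>) \<Longrightarrow> B k \<omega> = A k \<omega>"

definition null_state_recurrent ::
  "'w measure \<Rightarrow> (int \<Rightarrow> 'w \<Rightarrow> real) \<Rightarrow> (int \<Rightarrow> 'w \<Rightarrow> real) \<Rightarrow> bool" where
  "null_state_recurrent M A C \<longleftrightarrow>
     (AE \<omega> in M. \<forall>t. \<exists>t'\<ge>t. null_state (\<lambda>k. A k \<omega>) (\<lambda>k. C k \<omega>) t')"

text \<open>
  The rule may use the whole history of the system (through \<open>\<omega>\<close>) as well as extra randomness, but it
  does not depend on the absolute numbering of the customers or on the choice of the time origin.
\<close>

definition service_discipline ::
  "'w measure \<Rightarrow> ('w \<Rightarrow> 'w) \<Rightarrow> ('w \<Rightarrow> int \<Rightarrow> int set \<Rightarrow> int) \<Rightarrow> bool" where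
  "service_discipline M T D \<longleftrightarrow>
     (\<forall>k S. finite S \<and> S \<noteq> {} \<longrightarrow>
        (\<lambda>\<omega>. D \<omega> k S) \<in> measurable M (count_space UNIV) \<and>
        (\<forall>\<omega>\<in>space M. D \<omega> k S \<in> S \<and> D (T \<omega>) k S = D \<omega> (k + 1) ((\<lambda>j. j + 1) ` S) - 1))"

definition LCFS :: "'w \<Rightarrow> int \<Rightarrow> int set \<Rightarrow> int" where
  "LCFS \<omega> k S = Max S"

lemma service_discipline_LCFS: "service_discipline M T LCFS"
proof -
  have "Max ((\<lambda>j. j + 1) ` S) = Max S + 1" if "finite S" "S \<noteq> {}" for S :: "int set"
    using that by (intro mono_Max_commute[symmetric]) (auto simp: mono_def)
  then show ?thesis
    by (auto simp: service_discipline_def LCFS_def)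
qed

text \<open>
  Expectation and variance of a nonnegative random variable, with values in the extended reals. If
  the mean is infinite, then \<open>\<infinity> - \<infinity> = \<infinity>\<close> in type \<^typ>\<open>ereal\<close> makes the variance infinite.
\<close>

definition Ex :: "'w measure \<Rightarrow> ('w \<Rightarrow> real) \<Rightarrow> ereal" where
  "Ex M X = enn2ereal (\<integral>\<^sup>+\<omega>. ennreal (X \<omega>) \<partial>M)"

definition Var :: "'w measure \<Rightarrow> ('w \<Rightarrow> real) \<Rightarrow> ereal" where
  "Var M X = Ex M (\<lambda>\<omega>. (X \<omega>)\<^sup>2) - (Ex M X)\<^sup>2"

lemma (in prob_space) Var_eq_variance:
  assumes nonneg: "\<And>\<omega>. \<omega> \<in> space M \<Longrightarrow> 0 \<le> X \<omega>"
    and X: "integrable M X" and X2: "integrable M (\<lambda>\<omega>. (X \<omega>)\<^sup>2)"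
  shows "Var M X = ereal (variance X)"
proof -
  have "Ex M X = ereal (expectation X)"
    unfolding Ex_def using X nonneg
    by (subst nn_integral_eq_integral) (auto intro!: integral_nonneg_AE simp: enn2ereal_ennreal)
  moreover have "Ex M (\<lambda>\<omega>. (X \<omega>)\<^sup>2) = ereal (expectation (\<lambda>\<omega>. (X \<omega>)\<^sup>2))"
    unfolding Ex_def using X2
    by (subst nn_integral_eq_integral) (auto intro!: integral_nonneg_AE simp: enn2ereal_ennreal)
  ultimately show ?thesis
    by (simp add: Var_def variance_eq[OF X X2])
qed

end

theory Submission
  imports Defs
begin

text \<open>
  Within a cycle between two arrivals to the empty system, every discipline permutes the same customers
  over the same service intervals. So the total waiting time does not depend on the discipline, and the
  total squared waiting time depends on it only through \<open>- 2 * (\<Sum>k. a (\<pi>\<^sup>-\<^sup>1 k) * b k)\<close>. LCFS has always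
  served at least as many customers numbered \<open>x\<close> or higher as any other discipline, so it maximizes all
  partial sums of the arrival times in order of service; by summation by parts, it minimizes the
  sum of products. Stationarity carries this over to a typical customer: the expectation of a function
  of the waiting time of customer \<open>0\<close> equals the expectation of its sum over the cycle started by
  customer \<open>0\<close> (over the empty set if customer \<open>0\<close> does not find the system empty). Recurrence
  only speaks about the future, but by stationarity there is almost surely no first arrival to the
  empty system, so every customer belongs to a cycle.
\<close>

section \<open>The customers in order of service\<close>

text \<open>On one busy period this is the inverse of the permutation \<pi>: it leads from services
  to customers, so that inductions can run along the services.\<close>

definition pick ::
  "(int \<Rightarrow> real) \<Rightarrow> (int \<Rightarrow> real) \<Rightarrow> (int \<Rightarrow> int set \<Rightarrow> int) \<Rightarrow> int \<Rightarrow> nat \<Rightarrow> int" where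
  "pick a b d s n = d (s + int n) (waiting a b d s n)"

lemma served_eq_pick_image: "served a b d s n = pick a b d s ` {..<n}"
  by (induction n) (auto simp: pick_def waiting_def lessThan_Suc)

lemma waiting_eq: "waiting a b d s n = {j. s \<le> j \<and> a j \<le> b (s + int n)} - pick a b d s ` {..<n}"
  by (simp add: waiting_def served_eq_pick_image)

section \<open>Inequalities between finite sums\<close>

text \<open>Summation by parts in a form that carries an induction: the full sum may have either
  sign, and only earlier partial sums, which are nonpositive, have their factor raised from
  \<open>b n\<close> to \<open>b (Suc n)\<close>.\<close>

lemma weighted_sum_ge_last:
  fixes w b :: "nat \<Rightarrow> real"
  assumes "\<And>i. i \<le> n \<Longrightarrow> (\<Sum>k<i. w k) \<le> 0" and "mono b"
  shows "b n * (\<Sum>i<Suc n. w i) \<le> (\<Sum>i<Suc n. w i * b i)"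
  using assms(1)
proof (induction n)
  case 0
  then show ?case by simp
next
  case (Suc n)
  have "b (Suc n) * (\<Sum>i<Suc n. w i) \<le> b n * (\<Sum>i<Suc n. w i)"
    using Suc.prems[of "Suc n"] monoD[OF \<open>mono b\<close>, of n "Suc n"]
    by (intro mult_right_mono_neg) auto
  also have "\<dots> \<le> (\<Sum>i<Suc n. w i * b i)"
    using Suc.prems by (intro Suc.IH) auto
  finally show ?case
    by (simp add: algebra_simps)
qed

text \<open>For \<open>u - v\<close>, equal totals turn the left-hand side of the preceding bound
  into zero.\<close>

lemma weighted_sum_mono:
  fixes u v b :: "nat \<Rightarrow> real"
  assumes partial: "\<And>i. i \<le> n \<Longrightarrow> (\<Sum>k<i. u k) \<le> (\<Sum>k<i. v k)"
    and total: "(\<Sum>k<n. u k) = (\<Sum>k<n. v k)" and "mono b"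
  shows "(\<Sum>k<n. v k * b k) \<le> (\<Sum>k<n. u k * b k)"
proof (cases n)
  case (Suc m)
  have "b m * (\<Sum>i<Suc m. u i - v i) \<le> (\<Sum>i<Suc m. (u i - v i) * b i)"
    using partial Suc \<open>mono b\<close> by (intro weighted_sum_ge_last) (auto simp: sum_subtractf)
  moreover have "(\<Sum>i<Suc m. u i - v i) = 0"
    using total Suc by (simp add: sum_subtractf del: sum.lessThan_Suc)
  ultimately show ?thesis
    using Suc by (simp add: sum_subtractf algebra_simps del: sum.lessThan_Suc)
qed simp

lemma telescope_int:
  fixes f :: "int \<Rightarrow> real"
  assumes "s \<le> x"
  shows "f x = f s + (\<Sum>y\<in>{s<..x}. f y - f (y - 1))"
  using assms
proof (induction x rule: int_ge_induct)
  case (step x)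
  have "{s<..x + 1} = insert (x + 1) {s<..x}"
    using step by auto
  then show ?case
    using step by simp
qed simp

text \<open>Layer-cake formula: \<open>f (r i)\<close> is \<open>f s\<close> plus the increments of
  \<open>f\<close> at all \<open>y\<close> with \<open>s < y \<le> r i\<close>. After exchanging the
  sums, each increment, nonnegative by monotonicity, is weighted by a count. The bound
  \<open>t\<close> provides a common finite range for \<open>y\<close>.\<close>

lemma sum_mono_of_counts:
  fixes f :: "int \<Rightarrow> real" and p q :: "nat \<Rightarrow> int"
  assumes "mono f" and pq: "\<And>i. i < n \<Longrightarrow> s \<le> p i \<and> p i < t \<and> s \<le> q i \<and> q i < t"
    and counts: "\<And>x. card {i. i < n \<and> x \<le> p i} \<le> card {i. i < n \<and> x \<le> q i}"
  shows "(\<Sum>i<n. f (p i)) \<le> (\<Sum>i<n. f (q i))"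
proof -
  have *: "(\<Sum>i<n. f (r i)) =
      real n * f s + (\<Sum>y\<in>{s<..<t}. (f y - f (y - 1)) * real (card {i. i < n \<and> y \<le> r i}))"
    if "\<And>i. i < n \<Longrightarrow> s \<le> r i \<and> r i < t" for r
  proof -
    have card_eq: "(\<Sum>i<n. of_bool (y \<le> r i)) = real (card {i. i < n \<and> y \<le> r i})" for y
    proof -
      have "{..<n} \<inter> {i. y \<le> r i} = {i. i < n \<and> y \<le> r i}" by auto
      then show ?thesis by (simp add: sum_of_bool_eq)
    qed
    have "f (r i) = f s + (\<Sum>y\<in>{s<..<t}. (f y - f (y - 1)) * of_bool (y \<le> r i))"
      if "i < n" for i
    proof -
      have "(\<Sum>y\<in>{s<..r i}. f y - f (y - 1)) =
          (\<Sum>y\<in>{s<..<t}. (f y - f (y - 1)) * of_bool (y \<le> r i))"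
        using \<open>\<And>i. i < n \<Longrightarrow> s \<le> r i \<and> r i < t\<close>[OF that]
        by (intro sum.mono_neutral_cong_left) auto
      then show ?thesis
        using telescope_int[of s "r i" f] \<open>\<And>i. i < n \<Longrightarrow> s \<le> r i \<and> r i < t\<close>[OF that] by simp
    qed
    then have "(\<Sum>i<n. f (r i)) =
        real n * f s + (\<Sum>i<n. \<Sum>y\<in>{s<..<t}. (f y - f (y - 1)) * of_bool (y \<le> r i))"
      by (simp add: sum.distrib)
    also have "(\<Sum>i<n. \<Sum>y\<in>{s<..<t}. (f y - f (y - 1)) * of_bool (y \<le> r i)) =
        (\<Sum>y\<in>{s<..<t}. (f y - f (y - 1)) * (\<Sum>i<n. of_bool (y \<le> r i)))"
      by (subst sum.swap) (simp only: sum_distrib_left)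
    finally show ?thesis
      by (simp only: card_eq)
  qed
  have "0 \<le> f y - f (y - 1)" for y
    using monoD[OF \<open>mono f\<close>, of "y - 1" y] by simp
  then show ?thesis
    using pq counts by (auto simp: * intro!: sum_mono mult_left_mono)
qed

lemma card_less_Suc_if:
  "card {i. i < Suc n \<and> P i} = card {i. i < n \<and> P i} + (if P n then 1 else 0)"
proof -
  have "{i. i < Suc n \<and> P i} = (if P n then insert n {i. i < n \<and> P i} else {i. i < n \<and> P i})"
    by (auto simp: less_Suc_eq)
  then show ?thesis
    by simp
qed

section \<open>Comparison of disciplines on a single sample path\<close>

locale sample_path =
  fixes a b :: "int \<Rightarrow> real" and d :: "int \<Rightarrow> int set \<Rightarrow> int"
  assumes a_strict: "strict_mono a" and b_strict: "strict_mono b"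
    and a_unbounded: "filterlim a at_top at_top"
    and a_le_b: "\<And>k. a k \<le> b k"
    and d_in: "\<And>k S. finite S \<Longrightarrow> S \<noteq> {} \<Longrightarrow> d k S \<in> S"
begin

lemma finite_arrived: "finite {j. s \<le> j \<and> a j \<le> x}"
proof -
  obtain K where K: "\<And>k. K \<le> k \<Longrightarrow> x < a k"
    using a_unbounded unfolding filterlim_at_top_dense eventually_at_top_linorder by meson
  have "{j. s \<le> j \<and> a j \<le> x} \<subseteq> {s..<K}"
    using K by (force simp: not_le[symmetric])
  then show ?thesis
    by (rule finite_subset) simp
qed

lemma finite_waiting: "finite (waiting a b d s n)"
  unfolding waiting_def by (intro finite_Diff finite_arrived)

text \<open>Pigeonhole: the \<open>n + 1\<close> customers from \<open>s\<close> to
  \<open>s + int n\<close> have all arrived by \<open>b (s + int n)\<close>, and at most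
  \<open>n\<close> customers have been served.\<close>

lemma waiting_nonempty: "waiting a b d s n \<noteq> {}"
proof
  assume "waiting a b d s n = {}"
  moreover have "a j \<le> b (s + int n)" if "j \<le> s + int n" for j
    using that a_le_b[of "s + int n"] strict_mono_mono[OF a_strict, THEN monoD, of j "s + int n"]
    by linarith
  ultimately have "{s..s + int n} \<subseteq> pick a b d s ` {..<n}"
    by (fastforce simp: waiting_eq)
  then have "card {s..s + int n} \<le> card (pick a b d s ` {..<n})"
    by (intro card_mono) auto
  also have "\<dots> \<le> n"
    using card_image_le[of "{..<n}" "pick a b d s"] by simp
  finally show False
    by simp
qed

lemma pick_in_waiting: "pick a b d s n \<in> waiting a b d s n"
  unfolding pick_def by (intro d_in finite_waiting waiting_nonempty)

lemma pick_ge: "s \<le> pick a b d s n"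
  and a_pick_le: "a (pick a b d s n) \<le> b (s + int n)"
  and pick_fresh: "i < n \<Longrightarrow> pick a b d s n \<noteq> pick a b d s i"
  using pick_in_waiting[of s n] by (auto simp: waiting_eq)

lemma inj_pick: "inj (pick a b d s)"
  by (rule injI) (metis linorder_neqE_nat pick_fresh)

text \<open>The assumption on \<open>L\<close> holds when customer \<open>s + int L\<close> finds
  the system empty. All earlier services begin before that arrival, so they take earlier
  customers.\<close>

lemma pick_less:
  assumes "b (s + int L) = a (s + int L)" "n < L"
  shows "pick a b d s n < s + int L"
proof -
  have "a (pick a b d s n) < a (s + int L)"
    using a_pick_le[of s n] strict_monoD[OF b_strict, of "s + int n" "s + int L"] assms by linarith
  then show ?thesis
    using strict_mono_less[OF a_strict] by blast
qed

text \<open>An injection of \<open>L\<close> services into \<open>L\<close> customers is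
  onto.\<close>

lemma bij_pick:
  assumes "b (s + int L) = a (s + int L)"
  shows "bij_betw (pick a b d s) {..<L} {s..<s + int L}"
proof -
  have inj: "inj_on (pick a b d s) {..<L}"
    using inj_pick by (rule inj_on_subset) simp
  have "pick a b d s ` {..<L} = {s..<s + int L}"
    using pick_less[OF assms] pick_ge inj by (intro card_subset_eq) (auto simp: card_image)
  with inj show ?thesis
    by (simp add: bij_betw_def)
qed

text \<open>Nobody is served twice, so \<open>LEAST\<close> recovers the service of a customer, as
  in \<open>service_index\<close>. This passes from sums over customers to sums over
  services.\<close>

lemma sum_over_cycle:
  assumes "b (s + int L) = a (s + int L)"
  shows "(\<Sum>j\<in>{s..<s + int L}. f (b (s + int (LEAST n. pick a b d s n = j))) j) =
    (\<Sum>n<L. f (b (s + int n)) (pick a b d s n))"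
proof -
  have "(LEAST n'. pick a b d s n' = pick a b d s n) = n" for n
    using injD[OF inj_pick, of s] by (intro Least_equality) auto
  then show ?thesis
    by (subst sum.reindex_bij_betw[OF bij_pick[OF assms], symmetric]) simp
qed

text \<open>LCFS can lose ground only in a service where \<open>d\<close> takes a customer numbered
  \<open>x\<close> or higher and LCFS takes a lower one. In that case the bound comes from an
  inclusion between the sets of customers served.\<close>

lemma pick_count_le_LCFS:
  "card {i. i < n \<and> x \<le> pick a b d s i} \<le> card {i. i < n \<and> x \<le> pick a b (\<lambda>k S. Max S) s i}"
proof (induction n)
  case (Suc n)
  interpret L: sample_path a b "\<lambda>k S. Max S"
    using a_strict b_strict a_unbounded a_le_b by unfold_locales auto
  let ?p = "pick a b d s" and ?q = "pick a b (\<lambda>k S. Max S) s"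
  show ?case
  proof (cases "x \<le> ?p n \<and> \<not> x \<le> ?q n")
    case True
    \<comment> \<open>LCFS has already exhausted the arrivals numbered \<open>x\<close> or higher.\<close>
    have exhausted: "j \<in> ?q ` {..<n}" if "s \<le> j" "a j \<le> b (s + int n)" "x \<le> j" for j
    proof (rule ccontr)
      assume "j \<notin> ?q ` {..<n}"
      then have "j \<le> ?q n"
        using that L.finite_waiting[of s n] by (subst pick_def) (auto intro!: Max_ge simp: waiting_eq)
      with True that show False by simp
    qed
    \<comment> \<open>Everyone taken by \<open>d\<close> so far has arrived by now, so those
      numbered \<open>x\<close> or higher fall under \<open>exhausted\<close>.\<close>
    have "a (?p i) \<le> b (s + int n)" if "i \<le> n" for i
      using a_pick_le[of s i] strict_mono_mono[OF b_strict, THEN monoD, of "s + int i" "s + int n"] that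
      by simp
    then have "?p ` {i. i < Suc n \<and> x \<le> ?p i} \<subseteq> ?q ` {i. i < n \<and> x \<le> ?q i}"
      using exhausted pick_ge by (fastforce simp: less_Suc_eq_le)
    then have "card (?p ` {i. i < Suc n \<and> x \<le> ?p i}) \<le> card (?q ` {i. i < n \<and> x \<le> ?q i})"
      by (intro card_mono) auto
    then have "card {i. i < Suc n \<and> x \<le> ?p i} \<le> card {i. i < n \<and> x \<le> ?q i}"
      by (simp add: card_image inj_on_subset[OF inj_pick] inj_on_subset[OF L.inj_pick])
    then show ?thesis
      by (simp add: card_less_Suc_if[of n "\<lambda>i. x \<le> ?q i"])
  next
    case False
    then show ?thesis
      using Suc.IH by (auto simp: card_less_Suc_if)
  qed
qed simp

text \<open>The right-hand side is free of \<open>d\<close>; this is why the mean does not depend on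
  the discipline.\<close>

lemma cycle_total_wait:
  assumes "b (s + int L) = a (s + int L)"
  shows "(\<Sum>n<L. b (s + int n) - a (pick a b d s n)) =
    (\<Sum>n<L. b (s + int n)) - (\<Sum>j\<in>{s..<s + int L}. a j)"
  by (simp add: sum_subtractf sum.reindex_bij_betw[OF bij_pick[OF assms]])

lemma cycle_square_wait_le_LCFS:
  assumes "b (s + int L) = a (s + int L)"
  shows "(\<Sum>n<L. (b (s + int n) - a (pick a b d s n))\<^sup>2) \<le>
    (\<Sum>n<L. (b (s + int n) - a (pick a b (\<lambda>k S. Max S) s n))\<^sup>2)"
proof -
  interpret L: sample_path a b "\<lambda>k S. Max S"
    using a_strict b_strict a_unbounded a_le_b by unfold_locales auto
  let ?p = "pick a b d s" and ?q = "pick a b (\<lambda>k S. Max S) s"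
  have bij: "(\<Sum>n<L. f (?p n)) = (\<Sum>n<L. f (?q n))" for f :: "int \<Rightarrow> real"
    by (simp add: sum.reindex_bij_betw[OF bij_pick[OF assms]]
        sum.reindex_bij_betw[OF L.bij_pick[OF assms]])
  \<comment> \<open>The counts give LCFS the larger partial sums of arrival times, while the totals
    agree by \<open>bij\<close>.\<close>
  have "(\<Sum>n<L. a (?q n) * b (s + int n)) \<le> (\<Sum>n<L. a (?p n) * b (s + int n))"
  proof (rule weighted_sum_mono)
    show "(\<Sum>k<i. a (?p k)) \<le> (\<Sum>k<i. a (?q k))" if "i \<le> L" for i
      using that pick_ge pick_less[OF assms] L.pick_ge L.pick_less[OF assms]
      by (intro sum_mono_of_counts[where s = s and t = "s + int L"] pick_count_le_LCFS
          strict_mono_mono[OF a_strict]) auto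
    show "mono (\<lambda>k. b (s + int k))"
      using strict_mono_mono[OF b_strict] by (auto simp: mono_def)
  qed (rule bij)
  moreover have "(\<Sum>n<L. (b (s + int n) - a (r n))\<^sup>2) =
      (\<Sum>n<L. (b (s + int n))\<^sup>2) + (\<Sum>n<L. (a (r n))\<^sup>2) - 2 * (\<Sum>n<L. a (r n) * b (s + int n))"
    for r
    by (simp add: power2_diff sum.distrib sum_subtractf sum_distrib_left mult_ac)
  ultimately show ?thesis
    using bij[of "\<lambda>j. (a j)\<^sup>2"] by simp
qed

end

section \<open>Shift covariance and measurability\<close>

context queueing_system
begin

definition null_arrival :: "int \<Rightarrow> 'w \<Rightarrow> bool" where
  "null_arrival j \<omega> \<longleftrightarrow> null_state (\<lambda>k. A k \<omega>) (\<lambda>k. C k \<omega>) (A j \<omega>)"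

text \<open>
  Unlike \<open>busy_start\<close>, a \<open>LEAST\<close> over the natural numbers commutes with the shift even where the
  predicate is empty.
\<close>

definition lag :: "int \<Rightarrow> 'w \<Rightarrow> nat" where
  "lag j \<omega> = (LEAST m. null_arrival (j - int m) \<omega>)"

text \<open>A substitute for \<open>waiting_time\<close> that, for a service discipline, is
  measurable and shift covariant on all of \<open>space M\<close>. The two agree wherever some
  customer up to \<open>j\<close> found the system empty.\<close>

definition cycle_wait :: "('w \<Rightarrow> int \<Rightarrow> int set \<Rightarrow> int) \<Rightarrow> int \<Rightarrow> 'w \<Rightarrow> real" where
  "cycle_wait D j \<omega> = (let s = j - int (lag j \<omega>) in
     B (s + int (LEAST n. pick (\<lambda>k. A k \<omega>) (\<lambda>k. B k \<omega>) (D \<omega>) s n = j)) \<omega> - A j \<omega>)"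

lemma null_arrival_measurable [measurable]: "Measurable.pred M (null_arrival j)"
  unfolding null_arrival_def[abs_def] null_state_def by measurable

lemma lag_measurable [measurable]: "lag j \<in> measurable M (count_space UNIV)"
  unfolding lag_def[abs_def] by measurable

lemma T_space: "\<omega> \<in> space M \<Longrightarrow> T \<omega> \<in> space M"
  using T_measurable by (rule measurable_space)

lemma null_arrival_shift: "\<omega> \<in> space M \<Longrightarrow> null_arrival j (T \<omega>) \<longleftrightarrow> null_arrival (j + 1) \<omega>"
proof -
  assume \<omega>: "\<omega> \<in> space M"
  have "(\<forall>k. P (k + 1)) \<longleftrightarrow> (\<forall>k. P k)" for P :: "int \<Rightarrow> bool"
    by (metis diff_add_cancel)
  from this[of "\<lambda>k. A k \<omega> < A (j + 1) \<omega> \<longrightarrow> C k \<omega> \<le> A (j + 1) \<omega>"] show ?thesis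
    using \<omega> by (simp add: null_arrival_def null_state_def A_shift C_shift)
qed

lemma lag_shift: "\<omega> \<in> space M \<Longrightarrow> lag j (T \<omega>) = lag (j + 1) \<omega>"
  by (simp add: lag_def null_arrival_shift algebra_simps)

lemma sample_path:
  assumes "service_discipline M T D" "\<omega> \<in> space M"
  shows "sample_path (\<lambda>k. A k \<omega>) (\<lambda>k. B k \<omega>) (D \<omega>)"
  using assms A_strict B_strict A_unbounded A_le_B
  by unfold_locales (auto simp: service_discipline_def)

text \<open>The waiting set depends on all earlier picks, hence strong induction. Once the waiting
  sets agree up to translation, the covariance demanded of a discipline gives the next pick.\<close>

lemma pick_shift:
  assumes D: "service_discipline M T D" and \<omega>: "\<omega> \<in> space M"
  shows "pick (\<lambda>k. A k (T \<omega>)) (\<lambda>k. B k (T \<omega>)) (D (T \<omega>)) s n =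
    pick (\<lambda>k. A k \<omega>) (\<lambda>k. B k \<omega>) (D \<omega>) (s + 1) n - 1"
proof (induction n rule: less_induct)
  case (less n)
  let ?p = "pick (\<lambda>k. A k (T \<omega>)) (\<lambda>k. B k (T \<omega>)) (D (T \<omega>)) s"
  let ?q = "pick (\<lambda>k. A k \<omega>) (\<lambda>k. B k \<omega>) (D \<omega>) (s + 1)"
  let ?W = "waiting (\<lambda>k. A k (T \<omega>)) (\<lambda>k. B k (T \<omega>)) (D (T \<omega>)) s n"
  let ?V = "waiting (\<lambda>k. A k \<omega>) (\<lambda>k. B k \<omega>) (D \<omega>) (s + 1) n"
  interpret P: sample_path "\<lambda>k. A k (T \<omega>)" "\<lambda>k. B k (T \<omega>)" "D (T \<omega>)"
    using D \<omega> by (intro sample_path T_space)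
  have "?p ` {..<n} = (\<lambda>i. ?q i - 1) ` {..<n}"
    using less by (intro image_cong) auto
  then have "j \<in> ?p ` {..<n} \<longleftrightarrow> j + 1 \<in> ?q ` {..<n}" for j
    by (simp only: image_iff eq_diff_eq)
  then have mem: "j \<in> ?W \<longleftrightarrow> j + 1 \<in> ?V" for j
    unfolding waiting_eq Diff_iff mem_Collect_eq
    using \<omega> by (simp add: A_shift B_shift add_ac)
  have "j \<in> (\<lambda>j. j + 1) ` ?W" if "j \<in> ?V" for j
    using that mem[of "j - 1"] by (intro image_eqI[of _ _ "j - 1"]) auto
  then have "(\<lambda>j. j + 1) ` ?W = ?V"
    using mem by blast
  then show ?case
    using D \<omega> P.finite_waiting[of s n] P.waiting_nonempty[of s n]
    by (simp add: pick_def service_discipline_def algebra_simps)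
qed

lemma cycle_wait_shift:
  assumes "service_discipline M T D" "\<omega> \<in> space M"
  shows "cycle_wait D j (T \<omega>) = cycle_wait D (j + 1) \<omega>"
proof -
  have [simp]: "x - 1 = j \<longleftrightarrow> x = j + 1" for x :: int
    by auto
  show ?thesis
    unfolding cycle_wait_def Let_def pick_shift[OF assms] lag_shift[OF assms(2)]
    using assms(2) by (simp add: A_shift B_shift algebra_simps)
qed

text \<open>Measurability of a discipline is assumed for each fixed waiting set. The actual waiting
  set is random, but its values lie in the countable collection of finite nonempty sets, so it
  suffices that each value is taken on a measurable event.\<close>

lemma pick_measurable:
  assumes D: "service_discipline M T D"
  shows "(\<lambda>\<omega>. pick (\<lambda>k. A k \<omega>) (\<lambda>k. B k \<omega>) (D \<omega>) s n) \<in> measurable M (count_space UNIV)"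
proof (induction n rule: less_induct)
  case (less n)
  let ?W = "\<lambda>\<omega>. waiting (\<lambda>k. A k \<omega>) (\<lambda>k. B k \<omega>) (D \<omega>) s n"
  let ?I = "{S :: int set. finite S \<and> S \<noteq> {}}"
  have "countable ?I"
    by (rule countable_subset[OF _ countable_Collect_finite]) auto
  have "?W \<in> measurable M (count_space ?I)"
    unfolding measurable_count_space_eq_countable[OF \<open>countable ?I\<close>]
  proof (intro conjI ballI)
    show "?W \<in> space M \<rightarrow> ?I"
      using sample_path.finite_waiting[OF sample_path[OF D]]
        sample_path.waiting_nonempty[OF sample_path[OF D]] by auto
    fix S :: "int set"
    have "Measurable.pred M (\<lambda>\<omega>. pick (\<lambda>k. A k \<omega>) (\<lambda>k. B k \<omega>) (D \<omega>) s i \<noteq> j)"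
      if "i < n" for i j
      using measurable_compose[OF less[OF that], of "\<lambda>x. x \<noteq> j" "count_space UNIV"] by simp
    then have [measurable]: "Measurable.pred M
        (\<lambda>\<omega>. \<forall>i\<in>{..<n}. pick (\<lambda>k. A k \<omega>) (\<lambda>k. B k \<omega>) (D \<omega>) s i \<noteq> j)" for j
      by (intro pred_intros_finite) auto
    have "?W -` {S} \<inter> space M = {\<omega> \<in> space M. \<forall>j. (s \<le> j \<and> A j \<omega> \<le> B (s + int n) \<omega> \<and>
        (\<forall>i\<in>{..<n}. pick (\<lambda>k. A k \<omega>) (\<lambda>k. B k \<omega>) (D \<omega>) s i \<noteq> j)) \<longleftrightarrow> j \<in> S}"
      by (auto simp: waiting_eq)
    also have "\<dots> \<in> sets M"
      by measurable
    finally show "?W -` {S} \<inter> space M \<in> sets M" .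
  qed
  moreover have "(\<lambda>\<omega>. D \<omega> k S) \<in> measurable M (count_space UNIV)" if "S \<in> ?I" for k S
    using D that by (simp add: service_discipline_def)
  ultimately show ?case
    unfolding pick_def using \<open>countable ?I\<close>
    by (intro measurable_compose_countable'[where I = ?I and g = ?W and f = "\<lambda>S \<omega>. D \<omega> (s + int n) S"])
qed

lemma cycle_wait_measurable:
  assumes D: "service_discipline M T D"
  shows "cycle_wait D j \<in> borel_measurable M"
proof -
  note [measurable] = pick_measurable[OF D]
  \<comment> \<open>Two random indices are resolved by countable case distinction: here the service,
    with the start \<open>i\<close> fixed, and then the \<open>lag\<close>.\<close>
  have [measurable]: "(\<lambda>\<omega>. B (i + int (LEAST n. pick (\<lambda>k. A k \<omega>) (\<lambda>k. B k \<omega>) (D \<omega>) i n = j)) \<omega>)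
      \<in> borel_measurable M" for i
    by (rule measurable_compose_countable[where f = "\<lambda>k \<omega>. B (i + int k) \<omega>"]) measurable
  have "(\<lambda>\<omega>. B ((j - int (lag j \<omega>)) + int (LEAST n. pick (\<lambda>k. A k \<omega>) (\<lambda>k. B k \<omega>) (D \<omega>)
      (j - int (lag j \<omega>)) n = j)) \<omega>) \<in> borel_measurable M"
    by (rule measurable_compose_countable[where g = "lag j" and
        f = "\<lambda>l \<omega>. B ((j - int l) + int (LEAST n. pick (\<lambda>k. A k \<omega>) (\<lambda>k. B k \<omega>) (D \<omega>)
      (j - int l) n = j)) \<omega>"]) measurable
  then show ?thesis
    unfolding cycle_wait_def[abs_def] Let_def by measurable
qed

section \<open>Stationarity and the cycle formula\<close>

lemma nn_integral_shift:
  assumes "\<And>j. g j \<in> borel_measurable M"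
    and "\<And>j \<omega>. \<omega> \<in> space M \<Longrightarrow> g j (T \<omega>) = g (j + 1) \<omega>"
  shows "(\<integral>\<^sup>+\<omega>. g (int n) \<omega> \<partial>M) = (\<integral>\<^sup>+\<omega>. g 0 \<omega> \<partial>M)"
proof (induction n)
  case (Suc n)
  have "(\<integral>\<^sup>+\<omega>. g (int n) \<omega> \<partial>M) = (\<integral>\<^sup>+\<omega>. g (int n) \<omega> \<partial>distr M M T)"
    by (simp add: T_preserving)
  also have "\<dots> = (\<integral>\<^sup>+\<omega>. g (int n) (T \<omega>) \<partial>M)"
    using assms(1) by (intro nn_integral_distr) auto
  also have "\<dots> = (\<integral>\<^sup>+\<omega>. g (int (Suc n)) \<omega> \<partial>M)"
    using assms(2) by (intro nn_integral_cong) (simp add: add.commute)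
  finally show ?case
    using Suc by simp
qed simp

text \<open>
  The cycle formula: each customer sends the mass \<open>g j\<close> to the initiator of the busy period.
\<close>

lemma nn_integral_cycle:
  assumes g: "\<And>j. g j \<in> borel_measurable M"
    and shift: "\<And>j \<omega>. \<omega> \<in> space M \<Longrightarrow> g j (T \<omega>) = (g (j + 1) \<omega> :: ennreal)"
  shows "(\<integral>\<^sup>+\<omega>. g 0 \<omega> \<partial>M) = (\<integral>\<^sup>+\<omega>. (\<Sum>m. g (int m) \<omega> * of_bool (lag (int m) \<omega> = m)) \<partial>M)"
proof -
  note [measurable] = g
  have single: "(\<Sum>m. x * of_bool (l = m)) = x" for x :: ennreal and l :: nat
    by (subst suminf_finite[of "{l}"]) auto
  have "(\<integral>\<^sup>+\<omega>. g 0 \<omega> \<partial>M) = (\<integral>\<^sup>+\<omega>. (\<Sum>m. g 0 \<omega> * of_bool (lag 0 \<omega> = m)) \<partial>M)"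
    by (simp only: single)
  also have "\<dots> = (\<Sum>m. \<integral>\<^sup>+\<omega>. g 0 \<omega> * of_bool (lag 0 \<omega> = m) \<partial>M)"
    by (rule nn_integral_suminf) measurable
  \<comment> \<open>By \<open>m\<close> shifts, what customer \<open>0\<close> sends
    \<open>m\<close> places back has the same expectation as what customer \<open>m\<close> sends to
    \<open>0\<close>.\<close>
  also have "\<dots> = (\<Sum>m. \<integral>\<^sup>+\<omega>. g (int m) \<omega> * of_bool (lag (int m) \<omega> = m) \<partial>M)"
  proof (rule suminf_cong)
    fix m
    show "(\<integral>\<^sup>+\<omega>. g 0 \<omega> * of_bool (lag 0 \<omega> = m) \<partial>M) =
        (\<integral>\<^sup>+\<omega>. g (int m) \<omega> * of_bool (lag (int m) \<omega> = m) \<partial>M)"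
      by (rule nn_integral_shift[of "\<lambda>j \<omega>. g j \<omega> * of_bool (lag j \<omega> = m)", symmetric])
        (measurable, simp add: shift lag_shift)
  qed
  also have "\<dots> = (\<integral>\<^sup>+\<omega>. (\<Sum>m. g (int m) \<omega> * of_bool (lag (int m) \<omega> = m)) \<partial>M)"
    by (rule nn_integral_suminf[symmetric]) measurable
  finally show ?thesis .
qed

section \<open>Arrivals to the empty system, in the future and in the past\<close>

text \<open>The events \<open>F j\<close> that \<open>j\<close> is the first to find the system
  empty are disjoint and, by stationarity, equally likely. Infinitely many such events fit into a
  probability space only if they are null.\<close>

lemma AE_no_first_null_arrival:
  "AE \<omega> in M. \<forall>j. null_arrival j \<omega> \<longrightarrow> (\<exists>i<j. null_arrival i \<omega>)"
proof -
  define F where "F j = {\<omega> \<in> space M. null_arrival j \<omega> \<and> (\<forall>i. i < j \<longrightarrow> \<not> null_arrival i \<omega>)}" for j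
  have F [measurable]: "F j \<in> sets M" for j
    unfolding F_def by measurable
  have step: "emeasure M (F j) = emeasure M (F (j + 1))" for j
  proof -
    have "(\<forall>i. i < j \<longrightarrow> \<not> null_arrival (i + 1) \<omega>) \<longleftrightarrow> (\<forall>i. i < j + 1 \<longrightarrow> \<not> null_arrival i \<omega>)" for \<omega>
      by (metis add_less_cancel_right diff_add_cancel)
    then have "T -` F j \<inter> space M = F (j + 1)"
      by (auto simp: F_def null_arrival_shift T_space)
    moreover have "emeasure M (F j) = emeasure (distr M M T) (F j)"
      by (simp add: T_preserving)
    ultimately show ?thesis
      by (simp add: emeasure_distr)
  qed
  have const: "emeasure M (F j) = emeasure M (F 0)" for j
  proof (induction j rule: int_induct[where k = 0])
    case (step2 i)
    then show ?case using step[of "i - 1"] by simp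
  qed (use step in auto)
  have "disjoint_family (\<lambda>n. F (int n))"
  unfolding disjoint_family_on_def
  proof (intro ballI impI)
    fix m n :: nat
    assume "m \<noteq> n"
    then show "F (int m) \<inter> F (int n) = {}"
      unfolding F_def by (cases m n rule: linorder_cases) auto
  qed
  then have "(\<lambda>n. measure M (F (int n))) sums measure M (\<Union>n. F (int n))"
    by (intro finite_measure_UNION) auto
  then have "summable (\<lambda>n::nat. measure M (F 0))"
    unfolding measure_def const[of "int n" for n] by (rule sums_summable)
  then have "measure M (F 0) = 0"
    by (simp add: summable_const_iff)
  then have "F j \<in> null_sets M" for j
    using const[of j] by (auto simp: emeasure_eq_measure)
  then have "AE \<omega> in M. \<forall>j. \<omega> \<notin> F j"
    unfolding AE_all_countable by (auto intro: AE_not_in)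
  then show ?thesis
    by (rule AE_mp) (auto simp: F_def intro!: AE_I2)
qed

text \<open>The first customer to arrive at or after \<open>t\<close> finds the system empty: all
  earlier ones arrived before \<open>t\<close> and hence were gone by \<open>t\<close>.\<close>

lemma null_arrival_after:
  assumes \<omega>: "\<omega> \<in> space M" and null: "null_state (\<lambda>k. A k \<omega>) (\<lambda>k. C k \<omega>) t" and "A n \<omega> < t"
  shows "\<exists>k>n. null_arrival k \<omega>"
proof -
  have less_iff: "A i \<omega> < A j \<omega> \<longleftrightarrow> i < j" for i j
    using strict_mono_less[OF A_strict[OF \<omega>]] .
  obtain K where "t \<le> A K \<omega>"
    using A_unbounded[OF \<omega>] unfolding filterlim_at_top eventually_at_top_linorder by blast
  with \<open>A n \<omega> < t\<close> have "n < K"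
    using less_iff by fastforce
  with \<open>t \<le> A K \<omega>\<close> have ex: "t \<le> A (n + int (nat (K - n))) \<omega>"
    by simp
  define m where "m = (LEAST m. t \<le> A (n + int m) \<omega>)"
  have m: "t \<le> A (n + int m) \<omega>"
    unfolding m_def using ex by (rule LeastI)
  \<comment> \<open>So \<open>n + int (m - 1)\<close> makes sense as the last customer to arrive
    before \<open>t\<close>.\<close>
  have "m \<noteq> 0"
    using m \<open>A n \<omega> < t\<close> by (cases m) auto
  then have "A (n + int (m - 1)) \<omega> < t"
    using not_less_Least[of "m - 1" "\<lambda>m. t \<le> A (n + int m) \<omega>"] by (simp add: m_def)
  have "A k \<omega> < t" if "A k \<omega> < A (n + int m) \<omega>" for k
  proof -
    have "k \<le> n + int (m - 1)"
      using that \<open>m \<noteq> 0\<close> by (auto simp: less_iff)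
    then have "A k \<omega> \<le> A (n + int (m - 1)) \<omega>"
      using less_iff by (metis not_le)
    with \<open>A (n + int (m - 1)) \<omega> < t\<close> show ?thesis by simp
  qed
  then have "null_arrival (n + int m) \<omega>"
    using null m by (fastforce simp: null_arrival_def null_state_def)
  then show ?thesis
    using \<open>m \<noteq> 0\<close> by (intro exI[of _ "n + int m"]) auto
qed

text \<open>Recurrence supplies the later ones. If there were none up to \<open>n\<close>, those
  after \<open>n\<close> would include a first one, which almost surely does not exist.\<close>

lemma AE_null_arrivals:
  assumes "null_state_recurrent M A C"
  shows "AE \<omega> in M. (\<forall>n. \<exists>k>n. null_arrival k \<omega>) \<and> (\<forall>n. \<exists>k\<le>n. null_arrival k \<omega>)"
  using assms[unfolded null_state_recurrent_def] AE_no_first_null_arrival AE_space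
proof eventually_elim
  case (elim \<omega>)
  have after: "\<exists>k>n. null_arrival k \<omega>" for n
  proof -
    obtain t where "A n \<omega> + 1 \<le> t" "null_state (\<lambda>k. A k \<omega>) (\<lambda>k. C k \<omega>) t"
      using elim by blast
    then show ?thesis
      using elim by (intro null_arrival_after[of \<omega> t]) auto
  qed
  moreover have "\<exists>k\<le>n. null_arrival k \<omega>" for n
  proof (rule ccontr)
    assume no: "\<not> (\<exists>k\<le>n. null_arrival k \<omega>)"
    \<comment> \<open>Descent: such a \<open>j\<close> would be preceded by another one, again above
      \<open>n\<close>.\<close>
    have "\<not> null_arrival j \<omega>" if "n < j" for j
      using that
    proof (induction "nat (j - n)" arbitrary: j rule: less_induct)
      case less
      show ?case
      proof
        assume "null_arrival j \<omega>"
        then obtain i where "i < j" "null_arrival i \<omega>"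
          using elim by blast
        moreover have "n < i"
          using no \<open>null_arrival i \<omega>\<close> by (meson not_le)
        ultimately show False
          using less by auto
      qed
    qed
    with after[of n] show False by blast
  qed
  ultimately show ?case by blast
qed

section \<open>Waiting times summed over the cycle of customer \<open>0\<close>\<close>

lemma null_arrival_lag:
  assumes "\<exists>k\<le>j. null_arrival k \<omega>"
  shows "null_arrival (j - int (lag j \<omega>)) \<omega>"
proof -
  obtain k where "k \<le> j" "null_arrival k \<omega>"
    using assms by blast
  then have "null_arrival (j - int (nat (j - k))) \<omega>"
    by simp
  then show ?thesis
    unfolding lag_def by (rule LeastI)
qed

lemma busy_start_eq_lag:
  assumes "\<exists>k\<le>j. null_arrival k \<omega>"
  shows "busy_start (\<lambda>k. A k \<omega>) (\<lambda>k. C k \<omega>) j = j - int (lag j \<omega>)"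
proof -
  have "null_arrival (j - int (lag j \<omega>)) \<omega>"
    using assms by (rule null_arrival_lag)
  moreover have "i \<le> j - int (lag j \<omega>)" if "i \<le> j" "null_arrival i \<omega>" for i
  proof -
    have "lag j \<omega> \<le> nat (j - i)"
      unfolding lag_def using that by (intro Least_le) simp
    then show ?thesis
      using that by linarith
  qed
  ultimately show ?thesis
    unfolding busy_start_def null_arrival_def[symmetric]
    by (intro Greatest_equality) auto
qed

lemma waiting_time_eq_cycle_wait:
  assumes "\<exists>k\<le>j. null_arrival k \<omega>"
  shows "waiting_time A B C D j \<omega> = cycle_wait D j \<omega>"
  by (simp add: waiting_time_def service_index_def busy_start_eq_lag[OF assms] cycle_wait_def
      Let_def pick_def)

text \<open>\<open>L\<close> is the next customer after \<open>0\<close> to find the system empty,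
  so exactly the customers below \<open>L\<close> reach \<open>0\<close> when going back to the
  nearest such customer.\<close>

lemma cycle_of_origin:
  assumes null0: "null_arrival 0 \<omega>" and after: "\<exists>k>0. null_arrival k \<omega>" and \<omega>: "\<omega> \<in> space M"
  obtains L where "\<And>m. lag (int m) \<omega> = m \<longleftrightarrow> m < L" "B (int L) \<omega> = A (int L) \<omega>"
proof -
  define Q where "Q n \<longleftrightarrow> 0 < n \<and> null_arrival (int n) \<omega>" for n
  define L where "L = (LEAST n. Q n)"
  obtain k where "0 < k" "null_arrival k \<omega>"
    using after by blast
  then have "Q (nat k)"
    by (simp add: Q_def)
  then have L: "Q L"
    unfolding L_def by (rule LeastI)
  have below: "\<not> Q n" if "n < L" for n
    using that unfolding L_def by (rule not_less_Least)
  have "lag (int m) \<omega> = m \<longleftrightarrow> m < L" for m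
  proof
    assume lag: "lag (int m) \<omega> = m"
    show "m < L"
    proof (rule ccontr)
      assume "\<not> m < L"
      \<comment> \<open>Going back from \<open>m\<close>, one meets \<open>L\<close> before
        \<open>0\<close>.\<close>
      then have "lag (int m) \<omega> \<le> m - L"
        unfolding lag_def using L by (intro Least_le) (simp add: Q_def of_nat_diff)
      with lag L \<open>\<not> m < L\<close> show False
        unfolding Q_def by linarith
    qed
  next
    assume "m < L"
    show "lag (int m) \<omega> = m"
      unfolding lag_def
    proof (rule Least_equality)
      fix l assume l: "null_arrival (int m - int l) \<omega>"
      show "m \<le> l"
      proof (rule ccontr)
        assume "\<not> m \<le> l"
        then have "Q (m - l)"
          using l by (simp add: Q_def of_nat_diff)
        with below[of "m - l"] less_imp_diff_less[OF \<open>m < L\<close>] show False by blast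
      qed
    qed (simp add: null0)
  qed
  moreover have "B (int L) \<omega> = A (int L) \<omega>"
    using L immediate_service[OF \<omega>] by (simp add: Q_def null_arrival_def)
  ultimately show ?thesis
    using that by blast
qed

text \<open>Customers from \<open>L\<close> on contribute zero, and the others share the start
  \<open>m - m = 0\<close>. The series is thus a finite sum, which \<open>sum_over_cycle\<close>
  puts in order of service.\<close>

lemma cycle_sum:
  assumes D: "service_discipline M T D" and \<omega>: "\<omega> \<in> space M"
    and lag: "\<And>m. lag (int m) \<omega> = m \<longleftrightarrow> m < L" and L: "B (int L) \<omega> = A (int L) \<omega>"
  shows "(\<Sum>m. ennreal (f (cycle_wait D (int m) \<omega>)) * of_bool (lag (int m) \<omega> = m)) =
    (\<Sum>n<L. ennreal (f (B (int n) \<omega> - A (pick (\<lambda>k. A k \<omega>) (\<lambda>k. B k \<omega>) (D \<omega>) 0 n) \<omega>)))"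
proof -
  interpret P: sample_path "\<lambda>k. A k \<omega>" "\<lambda>k. B k \<omega>" "D \<omega>"
    using D \<omega> by (rule sample_path)
  let ?h = "\<lambda>j. ennreal (f (B (int (LEAST n. pick (\<lambda>k. A k \<omega>) (\<lambda>k. B k \<omega>) (D \<omega>) 0 n = j)) \<omega> - A j \<omega>))"
  have "(\<Sum>m. ennreal (f (cycle_wait D (int m) \<omega>)) * of_bool (lag (int m) \<omega> = m)) =
      (\<Sum>m<L. ennreal (f (cycle_wait D (int m) \<omega>)) * of_bool (lag (int m) \<omega> = m))"
    by (rule suminf_finite) (auto simp: lag)
  also have "\<dots> = (\<Sum>m<L. ?h (int m))"
  proof (rule sum.cong)
    fix m assume "m \<in> {..<L}"
    then have "lag (int m) \<omega> = m"
      using lag by simp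
    then show "ennreal (f (cycle_wait D (int m) \<omega>)) * of_bool (lag (int m) \<omega> = m) = ?h (int m)"
      by (simp add: cycle_wait_def)
  qed simp
  also have "\<dots> = (\<Sum>j\<in>{0..<0 + int L}. ?h j)"
    by (rule sum.reindex_bij_witness[where i = nat and j = int]) auto
  also have "\<dots> = (\<Sum>n<L. ennreal (f (B (int n) \<omega> - A (pick (\<lambda>k. A k \<omega>) (\<lambda>k. B k \<omega>) (D \<omega>) 0 n) \<omega>)))"
    using P.sum_over_cycle[of 0 L "\<lambda>x j. ennreal (f (x - A j \<omega>))"] L by simp
  finally show ?thesis .
qed

lemma nn_integral_waiting_time:
  assumes D: "service_discipline M T D" and rec: "null_state_recurrent M A C"
    and f [measurable]: "f \<in> borel_measurable borel"
  shows "(\<integral>\<^sup>+\<omega>. ennreal (f (waiting_time A B C D 0 \<omega>)) \<partial>M) =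
    (\<integral>\<^sup>+\<omega>. (\<Sum>m. ennreal (f (cycle_wait D (int m) \<omega>)) * of_bool (lag (int m) \<omega> = m)) \<partial>M)"
proof -
  note [measurable] = cycle_wait_measurable[OF D]
  have "(\<integral>\<^sup>+\<omega>. ennreal (f (waiting_time A B C D 0 \<omega>)) \<partial>M) =
      (\<integral>\<^sup>+\<omega>. ennreal (f (cycle_wait D 0 \<omega>)) \<partial>M)"
    using AE_null_arrivals[OF rec]
    by (intro nn_integral_cong_AE) (auto elim!: AE_mp simp: waiting_time_eq_cycle_wait)
  also have "\<dots> =
      (\<integral>\<^sup>+\<omega>. (\<Sum>m. ennreal (f (cycle_wait D (int m) \<omega>)) * of_bool (lag (int m) \<omega> = m)) \<partial>M)"
    by (rule nn_integral_cycle) (simp_all add: cycle_wait_shift[OF D])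
  finally show ?thesis .
qed

section \<open>Comparison of the moments with those under LCFS\<close>

lemma cycle_wait_sums_compare:
  assumes D: "service_discipline M T D" and \<omega>: "\<omega> \<in> space M"
    and after: "\<exists>k>0. null_arrival k \<omega>" and past: "\<forall>n. \<exists>k\<le>n. null_arrival k \<omega>"
  shows "(\<Sum>m. ennreal (cycle_wait D (int m) \<omega>) * of_bool (lag (int m) \<omega> = m)) =
      (\<Sum>m. ennreal (cycle_wait LCFS (int m) \<omega>) * of_bool (lag (int m) \<omega> = m))" (is ?mean)
    and "(\<Sum>m. ennreal ((cycle_wait D (int m) \<omega>)\<^sup>2) * of_bool (lag (int m) \<omega> = m)) \<le>
      (\<Sum>m. ennreal ((cycle_wait LCFS (int m) \<omega>)\<^sup>2) * of_bool (lag (int m) \<omega> = m))" (is ?square)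
proof -
  have "?mean \<and> ?square"
  proof (cases "null_arrival 0 \<omega>")
    case False
    \<comment> \<open>Equality would make \<open>0\<close> an arrival to the empty system. Hence
      both series vanish.\<close>
    have "lag (int m) \<omega> \<noteq> m" for m
      using null_arrival_lag[of "int m" \<omega>] past False by auto
    then show ?thesis
      by simp
  next
    case True
    obtain L
      where lag: "\<And>m. lag (int m) \<omega> = m \<longleftrightarrow> m < L" and L: "B (int L) \<omega> = A (int L) \<omega>"
      using cycle_of_origin[OF True after \<omega>] by metis
    interpret P: sample_path "\<lambda>k. A k \<omega>" "\<lambda>k. B k \<omega>" "D \<omega>"
      using D \<omega> by (rule sample_path)
    interpret L: sample_path "\<lambda>k. A k \<omega>" "\<lambda>k. B k \<omega>" "LCFS \<omega>"
      using service_discipline_LCFS \<omega> by (rule sample_path)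
    have LCFS: "LCFS \<omega> = (\<lambda>k S. Max S)"
      by (simp add: LCFS_def fun_eq_iff)
    note sums = cycle_sum[OF D \<omega> lag L] cycle_sum[OF service_discipline_LCFS \<omega> lag L]
    \<comment> \<open>By \<open>a_pick_le\<close> the individual waiting times are nonnegative, so
      their sum can be taken inside \<open>ennreal\<close>.\<close>
    have ?mean
      using sums[of "\<lambda>x. x"] P.cycle_total_wait[of 0 L] L.cycle_total_wait[of 0 L] L
        P.a_pick_le[of 0] L.a_pick_le[of 0]
      by (simp add: sum_ennreal)
    moreover have ?square
      using sums[of "\<lambda>x. x\<^sup>2"] P.cycle_square_wait_le_LCFS[of 0 L] L
      by (simp add: sum_ennreal LCFS ennreal_leI)
    ultimately show ?thesis ..
  qed
  then show ?mean ?square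
    by blast+
qed

lemma Ex_waiting_time_eq_LCFS:
  assumes D: "service_discipline M T D" and rec: "null_state_recurrent M A C"
  shows "Ex M (waiting_time A B C D 0) = Ex M (waiting_time A B C LCFS 0)"
proof -
  have "AE \<omega> in M. (\<Sum>m. ennreal (cycle_wait D (int m) \<omega>) * of_bool (lag (int m) \<omega> = m)) =
      (\<Sum>m. ennreal (cycle_wait LCFS (int m) \<omega>) * of_bool (lag (int m) \<omega> = m))"
    using AE_null_arrivals[OF rec] AE_space
    by eventually_elim (blast intro: cycle_wait_sums_compare(1)[OF D])
  then show ?thesis
    using nn_integral_waiting_time[OF D rec, of "\<lambda>x. x"]
      nn_integral_waiting_time[OF service_discipline_LCFS rec, of "\<lambda>x. x"]
    by (simp add: Ex_def nn_integral_cong_AE)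
qed

lemma Ex_square_waiting_time_le_LCFS:
  assumes D: "service_discipline M T D" and rec: "null_state_recurrent M A C"
  shows "Ex M (\<lambda>\<omega>. (waiting_time A B C D 0 \<omega>)\<^sup>2) \<le> Ex M (\<lambda>\<omega>. (waiting_time A B C LCFS 0 \<omega>)\<^sup>2)"
proof -
  have "AE \<omega> in M. (\<Sum>m. ennreal ((cycle_wait D (int m) \<omega>)\<^sup>2) * of_bool (lag (int m) \<omega> = m)) \<le>
      (\<Sum>m. ennreal ((cycle_wait LCFS (int m) \<omega>)\<^sup>2) * of_bool (lag (int m) \<omega> = m))"
    using AE_null_arrivals[OF rec] AE_space
    by eventually_elim (blast intro: cycle_wait_sums_compare(2)[OF D])
  then show ?thesis
    using nn_integral_waiting_time[OF D rec, of "\<lambda>x. x\<^sup>2"]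
      nn_integral_waiting_time[OF service_discipline_LCFS rec, of "\<lambda>x. x\<^sup>2"]
    by (simp add: Ex_def less_eq_ennreal.rep_eq[symmetric] nn_integral_mono_AE)
qed

end

theorem mainTheorem1:
  fixes M :: "'w measure" and T :: "'w \<Rightarrow> 'w" and A B C :: "int \<Rightarrow> 'w \<Rightarrow> real"
    and D :: "'w \<Rightarrow> int \<Rightarrow> int set \<Rightarrow> int"
  assumes "queueing_system M T A B C"
    and "null_state_recurrent M A C"
    and "service_discipline M T D"
  shows "Var M (waiting_time A B C D 0) \<le> Var M (waiting_time A B C LCFS 0)
    \<and> (Var M (waiting_time A B C D 0) = \<infinity> \<longrightarrow> Var M (waiting_time A B C LCFS 0) = \<infinity>)"
proof -
  interpret queueing_system M T A B C by fact
  \<comment> \<open>Both variances subtract the same squared mean, so second moments decide.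
    \<open>ereal_minus_mono\<close> covers infinite values too.\<close>
  have "Var M (waiting_time A B C D 0) \<le> Var M (waiting_time A B C LCFS 0)"
    unfolding Var_def Ex_waiting_time_eq_LCFS[OF assms(3,2)]
    by (intro ereal_minus_mono Ex_square_waiting_time_le_LCFS[OF assms(3,2)] order_refl)
  then show ?thesis
    by auto
qed

end
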